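(* Let $q\ge3$ be an odd integer and let $r\ge2$. Then $m_r-r>0$ (so all the path heights below are positive), and the following hold. If $r\in\mathcal L_q$, then $$a_q(r)=\operatorname{Cat}(r,m_r-r)=\frac1{m_r}\binom{m_r}{r};$$ more precisely, $\mathcal A_q(r)$ is in bijection with the rational Dyck paths from $(0,0)$ to $(r,m_r-r)$. If $r\in\mathcal U_q$, then $$a_q(r)=\operatorname{Cat}(r,m_r+1-r)=\frac1{m_r+1}\binom{m_r+1}{r},$$ and in this case $\mathcal A_q(r)$ is in bijection with the rational Dyck paths from $(0,0)$ to $(r,m_r+1-r)$.
   Context: For an odd integer $q\ge3$ put $\alpha_q=\log_2 q$ (irrational) and $m_r=\lfloor r\alpha_q\rfloor$. A $q$-admissible word of order $r\ge1$ is a finite word $w=(x_1,\dots,x_L)$ with each $x_j\in\{q/2,\,1/2\}$, containing exactly $r$ occurrences of $q/2$, such that $\prod_{j=1}^{\ell}x_j>1$ for all $1\le \ell<L$ and $\prod_{j=1}^{L}x_j<1$. Let $\mathcal A_q(r)$ be the set of $q$-admissible words of order $r$ and $a_q(r)=|\mathcal A_q(r)|$. Write the simple continued fraction $\alpha_q=[a_0;a_1,a_2,\dots]$ and let $Q_k$ be the denominator of its $k$-th convergent, with $Q_{-1}=0$, $Q_0=1$, $Q_{k+1}=a_{k+1}Q_k+Q_{k-1}$ for $k\ge0$. Set $$\mathcal L_q=\{sQ_k+Q_{k-1}: k\ge1\text{ odd},\ 0\le s<a_{k+1}\},$$ $$\mathcal U_q=\{sQ_k+Q_{k-1}: k\ge0\text{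 even},\ 0\le s<a_{k+1},\ (k,s)\ne(0,0)\}.$$ For coprime positive integers $a,b$, the rational Catalan number is $\operatorname{Cat}(a,b)=\frac1{a+b}\binom{a+b}{a}$. A rational Dyck path from $(0,0)$ to $(a,b)$ (with $a,b$ coprime positive integers) is a lattice path with unit east steps $E=(1,0)$ and north steps $N=(0,1)$ from $(0,0)$ to $(a,b)$ that stays weakly below the diagonal joining $(0,0)$ and $(a,b)$. *)

theory Defs
  imports Complex_Main
begin

definition log2_floor :: "nat \<Rightarrow> nat \<Rightarrow> nat" where
  "log2_floor q r = nat \<lfloor>real r * log 2 (real q)\<rfloor>"

(* The empty list is excluded by the last condition, since its product is 1. *)
definition admissible_words :: "nat \<Rightarrow> nat \<Rightarrow> real list set" where
  "admissible_words q r =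
     {w. set w \<subseteq> {real q / 2, 1 / 2} \<and>
         count_list w (real q / 2) = r \<and>
         (\<forall>l. 1 \<le> l \<and> l < length w \<longrightarrow> prod_list (take l w) > 1) \<and>
         prod_list w < 1}"

definition num_admissible :: "nat \<Rightarrow> nat \<Rightarrow> nat" where
  "num_admissible q r = card (admissible_words q r)"

(* Complete quotients of the simple continued fraction of an irrational number. (For rational x
   the expansion terminates and the later values are meaningless.) *)
fun cf_complete_quotient :: "real \<Rightarrow> nat \<Rightarrow> real" where
  "cf_complete_quotient x 0 = x"
| "cf_complete_quotient x (Suc k) = 1 / frac (cf_complete_quotient x k)"

definition cf_coeff :: "real \<Rightarrow> nat \<Rightarrow> int" where
  "cf_coeff x k = \<lfloor>cf_complete_quotient x k\<rfloor>"

(* Denominators of the convergents with the index shifted by one, to accommodate Q_{-1} = 0: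
   cf_denom_shift x n is Q_{n-1}, so that Q_k = cf_denom_shift x (Suc k) and
   Q_{k-1} = cf_denom_shift x k. The conversion to nat is harmless: for irrational x all partial
   quotients after the zeroth are positive. *)
fun cf_denom_shift :: "real \<Rightarrow> nat \<Rightarrow> nat" where
  "cf_denom_shift x 0 = 0"
| "cf_denom_shift x (Suc 0) = 1"
| "cf_denom_shift x (Suc (Suc k)) =
     nat (cf_coeff x (Suc k)) * cf_denom_shift x (Suc k) + cf_denom_shift x k"

definition lower_orders :: "nat \<Rightarrow> nat set" where
  "lower_orders q =
     {s * cf_denom_shift (log 2 (real q)) (Suc k) + cf_denom_shift (log 2 (real q)) k | k s.
        1 \<le> k \<and> odd k \<and> int s < cf_coeff (log 2 (real q)) (Suc k)}"

definition upper_orders :: "nat \<Rightarrow> nat set" where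
  "upper_orders q =
     {s * cf_denom_shift (log 2 (real q)) (Suc k) + cf_denom_shift (log 2 (real q)) k | k s.
        even k \<and> int s < cf_coeff (log 2 (real q)) (Suc k) \<and> (k, s) \<noteq> (0, 0)}"

(* Only meaningful for coprime positive a and b. *)
definition rational_catalan :: "nat \<Rightarrow> nat \<Rightarrow> real" where
  "rational_catalan a b = 1 / real (a + b) * real ((a + b) choose a)"

datatype step = East | North

(* Lattice paths are given by their step sequences. The prefix of length l ends at the point
   (x, y) with x the number of its east and y the number of its north steps; that point is weakly
   below the diagonal iff y <= (b / a) * x. As a half-plane is convex, it suffices to test the
   lattice points of the path. *)
definition rational_dyck_paths :: "nat \<Rightarrow> nat \<Rightarrow> step list set" where
  "rational_dyck_paths a b =
     {p. count_list p East = a \<and> count_list p North = b \<and>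
         (\<forall>l \<le> length p. a * count_list (take l p) North \<le> b * count_list (take l p) East)}"

end

theory Submission
  imports Defs "HOL-Combinatorics.Multiset_Permutations"
begin

text \<open>
  A prefix with \<open>i\<close> letters \<open>q/2\<close> and length \<open>l\<close> has product \<open>q ^ i / 2 ^ l\<close>, so admissibility compares
  \<open>l\<close> with \<open>i * log 2 q\<close>. The orders in question are denominators of intermediate convergents \<open>p/r\<close>;
  each forms, with a neighbouring convergent, a Farey pair enclosing \<open>log 2 q\<close>, and therefore no
  fraction with denominator at most \<open>r\<close> separates \<open>p/r\<close> from \<open>log 2 q\<close>. Hence \<open>log 2 q\<close> can be replaced
  by \<open>p/r\<close> in all the prefix conditions, which turns them into the Dyck condition. In the lower case
  the final forced letter \<open>1/2\<close> has to be removed first. The Dyck paths are counted by the cycle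
  lemma: every lattice path with the right endpoint has exactly one cyclic rotation below the diagonal.
\<close>

section \<open>Convergents and their errors\<close>

text \<open>Numerators of the convergents with the same index shift as the denominators:
  \<open>cf_num_shift x (Suc k)\<close> belongs to Q_k, and index 0 is the conventional P_{-1} =
  1.\<close>

fun cf_num_shift :: "real \<Rightarrow> nat \<Rightarrow> int" where
  "cf_num_shift x 0 = 1"
| "cf_num_shift x (Suc 0) = cf_coeff x 0"
| "cf_num_shift x (Suc (Suc k)) =
     cf_coeff x (Suc k) * cf_num_shift x (Suc k) + cf_num_shift x k"

definition cf_error :: "real \<Rightarrow> nat \<Rightarrow> real" where
  "cf_error x k = real (cf_denom_shift x k) * x - of_int (cf_num_shift x k)"

lemma frac_irrational:
  assumes "x \<notin> \<rat>"
  shows "frac x \<notin> \<rat>"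
proof
  assume "frac x \<in> \<rat>"
  then have "frac x + of_int \<lfloor>x\<rfloor> \<in> \<rat>"
    by (intro Rats_add) auto
  then show False
    using assms by (simp add: frac_def)
qed

lemma frac_pos_irrational:
  assumes "x \<notin> \<rat>"
  shows "0 < frac x"
proof -
  have "frac x \<noteq> 0"
    using frac_irrational[OF assms] by (metis Rats_0)
  then show ?thesis
    using frac_ge_0[of x] by linarith
qed

lemma cf_complete_quotient_irrational:
  assumes "x \<notin> \<rat>"
  shows "cf_complete_quotient x k \<notin> \<rat>"
proof (induction k)
  case (Suc k)
  show ?case
  proof
    assume "cf_complete_quotient x (Suc k) \<in> \<rat>"
    then have "inverse (cf_complete_quotient x (Suc k)) \<in> \<rat>"
      by (rule Rats_inverse)
    then show False
      using frac_irrational[OF Suc] by simp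
  qed
qed (use assms in simp)

lemma cf_complete_quotient_gt_1:
  assumes "x \<notin> \<rat>"
  shows "1 < cf_complete_quotient x (Suc k)"
  using frac_pos_irrational[OF cf_complete_quotient_irrational[OF assms], of k]
    frac_lt_1[of "cf_complete_quotient x k"] by simp

lemma cf_coeff_pos:
  assumes "x \<notin> \<rat>"
  shows "0 < cf_coeff x (Suc k)"
  using cf_complete_quotient_gt_1[OF assms, of k] unfolding cf_coeff_def by linarith

lemma cf_denom_shift_pos:
  assumes "x \<notin> \<rat>"
  shows "0 < cf_denom_shift x (Suc k)"
proof (induction k)
  case (Suc k)
  then show ?case
    using cf_coeff_pos[OF assms, of k] by simp
qed simp

lemma cf_error_Suc_Suc:
  assumes "x \<notin> \<rat>"
  shows "cf_error x (Suc (Suc k)) = of_int (cf_coeff x (Suc k)) * cf_error x (Suc k) + cf_error x k"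
  using cf_coeff_pos[OF assms, of k] by (simp add: cf_error_def algebra_simps)

text \<open>Complete quotients are the negated ratios of consecutive errors. By the recurrence, the
  next error is the current one times floor minus quotient, that is minus the fractional part, whose
  reciprocal is the next complete quotient.\<close>

lemma cf_error_Suc:
  assumes "x \<notin> \<rat>"
  shows "cf_error x k = - cf_complete_quotient x (Suc k) * cf_error x (Suc k)"
proof (induction k)
  case 0
  have "x - of_int \<lfloor>x\<rfloor> = frac x" by (simp add: frac_def)
  then show ?case
    using frac_pos_irrational[OF assms] by (simp add: cf_error_def cf_coeff_def)
next
  case (Suc k)
  let ?z = "cf_complete_quotient x (Suc k)"
  have "cf_error x (Suc (Suc k)) = (of_int \<lfloor>?z\<rfloor> - ?z) * cf_error x (Suc k)"
    unfolding cf_error_Suc_Suc[OF assms] Suc cf_coeff_def by (simp only: left_diff_distrib mult_minus_left)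
  also have "\<dots> = - frac ?z * cf_error x (Suc k)"
    unfolding frac_def by simp
  finally have *: "cf_error x (Suc (Suc k)) = - frac ?z * cf_error x (Suc k)" .
  have "0 < frac ?z"
    using frac_pos_irrational[OF cf_complete_quotient_irrational[OF assms]] .
  then show ?case
    unfolding * cf_complete_quotient.simps(2)[of x "Suc k"] by (simp del: cf_complete_quotient.simps)
qed

text \<open>The errors alternate in sign because their consecutive ratios are negative; the initial
  error is -1.\<close>

lemma cf_error_sign:
  assumes "x \<notin> \<rat>"
  shows "(- 1) ^ k * cf_error x k < 0"
proof (induction k)
  case 0
  show ?case by (simp add: cf_error_def)
next
  case (Suc k)
  have "0 < cf_complete_quotient x (Suc k)"
    using cf_complete_quotient_gt_1[OF assms, of k] by linarith
  moreover have "cf_complete_quotient x (Suc k) * ((- 1) ^ Suc k * cf_error x (Suc k)) < 0"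
    using Suc unfolding cf_error_Suc[OF assms, of k]
    by (simp add: algebra_simps del: cf_complete_quotient.simps)
  moreover have "d < 0" if "0 < c" "c * d < 0" for c d :: real
    using that by (simp add: mult_less_0_iff)
  ultimately show ?case by blast
qed

lemma cf_determinant:
  assumes "x \<notin> \<rat>"
  shows "cf_num_shift x (Suc k) * int (cf_denom_shift x k)
       - cf_num_shift x k * int (cf_denom_shift x (Suc k)) = (- 1) ^ Suc k"
proof (induction k)
  case (Suc k)
  then show ?case
    using cf_coeff_pos[OF assms, of k] by (simp add: algebra_simps)
qed simp

text \<open>The combined error equals (s - z) times the error at \<open>Suc k\<close>, where z is
  the complete quotient. Since s < floor z, the factor s - z is negative, so all these intermediate
  fractions lie on the side opposite to the convergent with index k.\<close>

lemma intermediate_error_sign: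
  assumes "x \<notin> \<rat>" and "int s < cf_coeff x (Suc k)"
  shows "(- 1) ^ k * (real s * cf_error x (Suc k) + cf_error x k) < 0"
proof -
  let ?z = "cf_complete_quotient x (Suc k)"
  have "real s < ?z"
    using assms(2) unfolding cf_coeff_def by linarith
  moreover have "0 < (- 1) ^ k * cf_error x (Suc k)"
    using cf_error_sign[OF assms(1), of "Suc k"] by simp
  ultimately have "(real s - ?z) * ((- 1) ^ k * cf_error x (Suc k)) < 0"
    by (intro mult_neg_pos) auto
  also have "(real s - ?z) * ((- 1) ^ k * cf_error x (Suc k))
      = (- 1) ^ k * (real s * cf_error x (Suc k) + cf_error x k)"
    unfolding cf_error_Suc[OF assms(1), of k]
    by (simp add: algebra_simps del: cf_complete_quotient.simps)
  finally show ?thesis .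
qed

section \<open>Farey neighbours\<close>

lemma bezout_imp_coprime:
  fixes a b u v :: int
  assumes "u * a - b * v = 1"
  shows "coprime a b"
proof (rule coprimeI)
  fix d
  assume "d dvd a" "d dvd b"
  then have "d dvd u * a - b * v"
    by (intro dvd_diff dvd_mult dvd_mult2)
  then show "is_unit d"
    using assms by simp
qed

text \<open>Transitivity of n/i <= x < P/Q with denominators cleared. Eliminating the real x leaves
  a strict inequality of integers, hence a gap of at least 1.\<close>

lemma cross_mult_less:
  fixes x :: real and i n P Q :: int
  assumes "of_int n \<le> of_int i * x" and "of_int Q * x < of_int P" and "0 < Q" and "0 < i"
  shows "n * Q < i * P"
proof -
  have "of_int n * of_int Q \<le> of_int i * x * of_int Q"
    using assms by (intro mult_right_mono) auto
  also have "\<dots> < of_int i * (of_int P :: real)"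
    using assms by (simp add: mult.commute mult.left_commute)
  finally have "of_int (n * Q) < (of_int (i * P) :: real)"
    by simp
  then show ?thesis
    by (simp only: of_int_less_iff)
qed

text \<open>If n/i exceeded p/r without exceeding x, then n r - i p and i P - n Q would both be at
  least 1. Weighting them by Q and r gives i times the determinant, so i >= r + Q > r.\<close>

lemma farey_lower:
  fixes x :: real and r p Q P i n :: int
  assumes "0 < r" "0 < Q" "P * r - p * Q = 1" "of_int p < of_int r * x" "of_int Q * x < of_int P"
    and "0 \<le> i" "i \<le> r"
  shows "of_int n \<le> of_int i * x \<longleftrightarrow> n * r \<le> i * p"
proof (cases "i = 0")
  case True
  then show ?thesis
    using assms(1) by (simp add: mult_le_0_iff)
next
  case False
  with assms have i: "0 < i" by simp
  show ?thesis
  proof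
    assume *: "of_int n \<le> of_int i * x"
    show "n * r \<le> i * p"
    proof (rule ccontr)
      assume "\<not> n * r \<le> i * p"
      then have "1 \<le> n * r - i * p" by simp
      moreover have "1 \<le> i * P - n * Q"
        using cross_mult_less[OF * assms(5,2) i] by simp
      ultimately have "r * 1 + Q * 1 \<le> r * (i * P - n * Q) + Q * (n * r - i * p)"
        using assms(1,2) by (intro add_mono mult_left_mono) auto
      also have "\<dots> = i * (P * r - p * Q)"
        by (simp add: algebra_simps)
      finally show False
        using assms by simp
    qed
  next
    assume *: "n * r \<le> i * p"
    have "of_int r * of_int n \<le> of_int i * (of_int p :: real)"
      using * by (metis mult.commute of_int_le_iff of_int_mult)
    also have "\<dots> \<le> of_int i * (of_int r * x)"
      using i assms(4) by (intro mult_left_mono) auto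
    finally have "of_int r * of_int n \<le> of_int r * (of_int i * x)"
      by (simp add: mult.left_commute)
    then show "of_int n \<le> of_int i * x"
      using assms(1) by simp
  qed
qed

text \<open>The excluded pair is the fraction \<open>p/r\<close> itself, which lies above \<open>x\<close>.\<close>

lemma farey_upper:
  fixes x :: real and r p Q P i n :: int
  assumes "0 < r" "0 < Q" "p * Q - P * r = 1" "of_int r * x < of_int p" "of_int P < of_int Q * x"
    and "0 \<le> i" "i \<le> r" "(i, n) \<noteq> (r, p)"
  shows "of_int n \<le> of_int i * x \<longleftrightarrow> n * r \<le> i * p"
proof (cases "i = 0")
  case True
  then show ?thesis
    using assms(1) by (simp add: mult_le_0_iff)
next
  case False
  with assms have i: "0 < i" by simp
  show ?thesis
  proof
    assume "of_int n \<le> of_int i * x"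
    then show "n * r \<le> i * p"
      using cross_mult_less[of n i x r p] assms i by simp
  next
    assume *: "n * r \<le> i * p"
    show "of_int n \<le> of_int i * x"
    proof (rule ccontr)
      assume "\<not> of_int n \<le> of_int i * x"
      \<comment> \<open>Negating all fractions turns P/Q < x < n/i into the shape that
        \<open>cross_mult_less\<close> expects.\<close>
      then have "(- n) * Q < i * (- P)"
        using assms(2,5) i by (intro cross_mult_less[of "- n" i "- x" Q "- P"]) auto
      then have "1 \<le> n * Q - i * P" by simp
      \<comment> \<open>Here i p - n r may vanish, so the weighted sum yields only i >= r. Equality
        then forces i = r and n = p, the excluded pair.\<close>
      then have "r * 1 + Q * (i * p - n * r) \<le> r * (n * Q - i * P) + Q * (i * p - n * r)"
        using assms(1) by (intro add_right_mono mult_left_mono) auto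
      also have "\<dots> = i * (p * Q - P * r)"
        by (simp add: algebra_simps)
      finally have le: "r + Q * (i * p - n * r) \<le> i"
        using assms(3) by simp
      moreover have nonneg: "0 \<le> Q * (i * p - n * r)"
        using * assms(2) by (intro mult_nonneg_nonneg) auto
      ultimately have ir: "i = r" using assms(7) by simp
      with le nonneg have "Q * (i * p - n * r) = 0" by simp
      then have "r * (p - n) = 0"
        using assms(2) ir by (simp add: algebra_simps)
      then show False
        using assms(1,8) ir by simp
    qed
  qed
qed

section \<open>The cycle lemma\<close>

definition step_words :: "nat \<Rightarrow> nat \<Rightarrow> step list set" where
  "step_words a b = {p. count_list p East = a \<and> count_list p North = b}"

lemma count_East_North: "count_list p East + count_list p North = length p"
proof (induction p)
  case (Cons s p)
  then show ?case by (cases s) auto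
qed simp

lemma step_words_eq_permutations:
  "step_words a b = permutations_of_multiset (replicate_mset a East + replicate_mset b North)"
proof -
  have "count_list p East = a \<and> count_list p North = b \<longleftrightarrow>
      mset p = replicate_mset a East + replicate_mset b North" for p
  proof -
    have "(\<forall>s. P s) \<longleftrightarrow> P East \<and> P North" for P
      by (metis step.exhaust)
    then show ?thesis
      by (simp add: multiset_eq_iff count_mset)
  qed
  then show ?thesis
    by (auto simp: step_words_def permutations_of_multiset_def)
qed

lemma finite_step_words: "finite (step_words a b)"
  by (simp add: step_words_eq_permutations)

lemma card_step_words: "card (step_words a b) = (a + b) choose a"
proof -
  let ?A = "replicate_mset a East + replicate_mset b North"
  \<comment> \<open>If \<open>a\<close> or \<open>b\<close> is 0, a letter is absent from the
    multiset; it may still be included in the product because its factor is \<open>fact 0\<close> =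
    1.\<close>
  have "(\<Prod>s\<in>set_mset ?A. fact (count ?A s)) = (\<Prod>s\<in>{East, North}. fact (count ?A s) :: nat)"
    by (rule prod.mono_neutral_left) (auto split: if_splits)
  then show ?thesis
    by (simp add: step_words_eq_permutations card_permutations_of_multiset binomial_fact')
qed

text \<open>Scaled signed distance of the endpoint from the diagonal, nonnegative below it.\<close>

definition path_height :: "nat \<Rightarrow> nat \<Rightarrow> step list \<Rightarrow> int" where
  "path_height a b p = int b * int (count_list p East) - int a * int (count_list p North)"

lemma path_height_append: "path_height a b (p @ p') = path_height a b p + path_height a b p'"
  by (simp add: path_height_def algebra_simps)

lemma path_height_step_words:
  assumes "p \<in> step_words a b"
  shows "path_height a b p = 0"
  using assms by (simp add: path_height_def step_words_def)

lemma length_step_words: "p \<in> step_words a b \<Longrightarrow> length p = a + b"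
  using count_East_North[of p] by (simp add: step_words_def)

text \<open>The full path has height 0, so only the positions \<open>l < a + b\<close> need testing.
  These can be read as residues modulo \<open>a + b\<close> when the path is rotated.\<close>

lemma rational_dyck_paths_height:
  "rational_dyck_paths a b =
     {p \<in> step_words a b. \<forall>l < a + b. 0 \<le> path_height a b (take l p)}"
proof -
  have "a * count_list p' North \<le> b * count_list p' East \<longleftrightarrow> 0 \<le> path_height a b p'" for p'
    unfolding path_height_def by (simp flip: of_nat_mult)
  moreover have "(\<forall>l \<le> length p. 0 \<le> path_height a b (take l p)) \<longleftrightarrow>
      (\<forall>l < a + b. 0 \<le> path_height a b (take l p))" if "p \<in> step_words a b" for p
    using path_height_step_words[OF that] length_step_words[OF that]
    by (metis le_neq_implies_less less_imp_le order_refl take_all)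
  ultimately show ?thesis
    by (auto simp: rational_dyck_paths_def step_words_def)
qed

section \<open>Cyclic rotations of lattice paths\<close>

lemma count_list_rotate: "count_list (rotate k p) x = count_list p x"
proof -
  have "count_list (take n p) x + count_list (drop n p) x = count_list p x" for n
    by (metis append_take_drop_id count_list_append)
  then show ?thesis
    by (metis rotate_drop_take count_list_append add.commute)
qed

lemma rotate_step_words: "rotate k p \<in> step_words a b \<longleftrightarrow> p \<in> step_words a b"
  by (simp add: step_words_def count_list_rotate)

text \<open>Rotation shifts the height profile cyclically and measures it from the new starting
  point; wrapping around adds nothing because the total height is 0.\<close>

lemma path_height_take_rotate:
  assumes "p \<in> step_words a b" and "k < a + b" and "l \<le> a + b"
  shows "path_height a b (take l (rotate k p)) =
    path_height a b (take ((k + l) mod (a + b)) p) - path_height a b (take k p)"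
proof -
  have len: "length p = a + b"
    using assms(1) by (rule length_step_words)
  have rot: "rotate k p = drop k p @ take k p"
    using assms(2) len by (simp add: rotate_drop_take)
  have split: "path_height a b (take k p) + path_height a b (drop k p) = 0"
    using path_height_step_words[OF assms(1)] path_height_append[of a b "take k p" "drop k p"] by simp
  consider "k + l < a + b" | "k + l = a + b" | "a + b < k + l" by linarith
  then show ?thesis
  proof cases
    case 1
    then have "take (k + l) p = take k p @ take l (drop k p)"
      by (simp add: take_add)
    with 1 show ?thesis
      using len by (simp add: rot path_height_append)
  next
    case 2
    then have "take l (rotate k p) = drop k p"
      using len assms by (simp add: rot)
    with 2 split show ?thesis
      by (simp add: path_height_def)
  next
    case 3
    then have "(k + l) mod (a + b) = k + l - (a + b)"
      using assms by (simp add: mod_if)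
    moreover have "take l (rotate k p) = drop k p @ take (k + l - (a + b)) p"
      using len assms 3 by (simp add: rot min_absorb1 add.commute)
    ultimately show ?thesis
      using split by (simp add: path_height_append)
  qed
qed

lemma bij_rotate: "bij (rotate k)"
  unfolding rotate_def by (rule bij_fn[OF bij_rotate1])

text \<open>Heights of the rotated path are measured from position \<open>k\<close>, so the rotation
  stays below the diagonal exactly when \<open>k\<close> minimises the height.\<close>

lemma rotate_dyck_iff:
  assumes "p \<in> step_words a b" and "k < a + b"
  shows "rotate k p \<in> rational_dyck_paths a b \<longleftrightarrow>
    (\<forall>l < a + b. path_height a b (take k p) \<le> path_height a b (take l p))"
proof -
  let ?h = "\<lambda>l. path_height a b (take l p)"
  have "rotate k p \<in> rational_dyck_paths a b \<longleftrightarrow> (\<forall>l < a + b. ?h k \<le> ?h ((k + l) mod (a + b)))"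
    using assms path_height_take_rotate[OF assms]
    by (auto simp: rational_dyck_paths_height rotate_step_words)
  also have "\<dots> \<longleftrightarrow> (\<forall>l < a + b. ?h k \<le> ?h l)"
  proof
    assume *: "\<forall>l < a + b. ?h k \<le> ?h ((k + l) mod (a + b))"
    show "\<forall>l < a + b. ?h k \<le> ?h l"
    proof (intro allI impI)
      fix l assume "l < a + b"
      \<comment> \<open>Each position \<open>l\<close> is reached from \<open>k\<close> by a cyclic
        shift; adding \<open>a + b\<close> before subtracting \<open>k\<close> avoids truncation in
        the naturals.\<close>
      then have "(k + (l + (a + b) - k) mod (a + b)) mod (a + b) = l"
        using assms(2) by (simp add: mod_add_right_eq)
      with * \<open>l < a + b\<close> show "?h k \<le> ?h l"
        by (metis add_strict_increasing2 gr_implies_not0 mod_less_divisor not_gr_zero)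
    qed
  next
    have "(k + l) mod (a + b) < a + b" for l
      using assms(2) by (intro mod_less_divisor) linarith
    then show "\<forall>l < a + b. ?h k \<le> ?h ((k + l) mod (a + b))" if "\<forall>l < a + b. ?h k \<le> ?h l"
      using that by blast
  qed
  finally show ?thesis .
qed

text \<open>Modulo \<open>a + b\<close> the height after \<open>l\<close> steps is \<open>- a l\<close>.\<close>

lemma path_height_inj:
  assumes "p \<in> step_words a b" and "coprime a b" and "k < a + b" and "l < a + b"
    and "path_height a b (take k p) = path_height a b (take l p)"
  shows "k = l"
proof -
  have height: "path_height a b (take n p) =
      int (a + b) * int (count_list (take n p) East) - int a * int n" if "n < a + b" for n
  proof -
    have "int n = int (count_list (take n p) East) + int (count_list (take n p) North)"
      using count_East_North[of "take n p"] length_step_words[OF assms(1)] that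
      by (simp flip: of_nat_add)
    then show ?thesis
      by (simp add: path_height_def algebra_simps)
  qed
  have "int a * (int k - int l) = int (a + b) *
      (int (count_list (take k p) East) - int (count_list (take l p) East))"
    using assms(5) unfolding height[OF assms(3)] height[OF assms(4)] by (simp add: algebra_simps)
  then have "int (a + b) dvd int a * (int k - int l)"
    by simp
  moreover have "coprime (int (a + b)) (int a)"
    using assms(2) by (metis coprime_commute coprime_iff_gcd_eq_1 coprime_int_iff gcd_add2)
  ultimately have "int (a + b) dvd int k - int l"
    by (simp add: coprime_dvd_mult_right_iff)
  then have "int k mod int (a + b) = int l mod int (a + b)"
    by (simp add: mod_eq_dvd_iff)
  then show ?thesis
    using assms(3,4) by simp
qed

lemma card_rational_dyck_paths:
  assumes "coprime a b" and "0 < a"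
  shows "(a + b) * card (rational_dyck_paths a b) = (a + b) choose a"
proof -
  let ?S = "step_words a b" and ?D = "rational_dyck_paths a b"
  have unique: "card {k \<in> {..<a + b}. rotate k p \<in> ?D} = 1" if p: "p \<in> ?S" for p
  proof -
    let ?h = "\<lambda>l. path_height a b (take l p)"
    have "\<exists>k. is_arg_min ?h (\<lambda>k. k \<in> {..<a + b}) k"
      using assms(2) by (intro ex_is_arg_min_if_finite) auto
    then obtain k where k: "k < a + b" "\<forall>l < a + b. ?h k \<le> ?h l"
      by (auto simp: is_arg_min_linorder)
    have "{k \<in> {..<a + b}. rotate k p \<in> ?D} = {k}"
    proof (intro set_eqI iffI)
      fix l assume "l \<in> {k \<in> {..<a + b}. rotate k p \<in> ?D}"
      then have l: "l < a + b" "\<forall>n < a + b. ?h l \<le> ?h n"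
        using rotate_dyck_iff[OF p] by auto
      with k have "?h l = ?h k" by (simp add: order_antisym)
      then show "l \<in> {k}"
        using path_height_inj[OF p assms(1)] k l by blast
    qed (use k rotate_dyck_iff[OF p] in auto)
    then show ?thesis by simp
  qed
  have fibre: "card {p \<in> ?S. rotate k p \<in> ?D} = card ?D" for k
  proof -
    have "inj_on (rotate k) {p \<in> ?S. rotate k p \<in> ?D}"
      by (meson bij_rotate bij_is_inj inj_on_subset subset_UNIV)
    moreover have "rotate k ` {p \<in> ?S. rotate k p \<in> ?D} = ?D"
    proof
      show "?D \<subseteq> rotate k ` {p \<in> ?S. rotate k p \<in> ?D}"
      proof
        fix d assume d: "d \<in> ?D"
        obtain p where "d = rotate k p"
          using bij_rotate by (metis bij_pointE)
        with d have "p \<in> ?S"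
          by (simp add: rational_dyck_paths_height rotate_step_words)
        with d \<open>d = rotate k p\<close> show "d \<in> rotate k ` {p \<in> ?S. rotate k p \<in> ?D}" by blast
      qed
    qed auto
    ultimately show ?thesis
      by (metis card_image)
  qed
  have "(\<Sum>k\<in>{..<a + b}. card {p \<in> ?S. rotate k p \<in> ?D}) =
      1 * card ?S"
    using finite_step_words unique by (intro sum_multicount) auto
  then show ?thesis
    by (simp add: fibre card_step_words)
qed

lemma card_rational_dyck_paths_catalan:
  assumes "coprime a b" and "0 < a"
  shows "real (card (rational_dyck_paths a b)) = rational_catalan a b"
proof -
  have "real (a + b) * real (card (rational_dyck_paths a b)) = real ((a + b) choose a)"
    using card_rational_dyck_paths[OF assms] by (metis of_nat_mult)
  then show ?thesis
    using assms(2) by (simp add: rational_catalan_def field_simps)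
qed

text \<open>With i east and j north steps, adding r i to both sides of r j <= (M - r) i gives r (i +
  j) <= i M. The Dyck condition thus compares the prefix length with i M / r, the form in which the
  Farey criteria apply.\<close>

lemma rational_dyck_paths_slope:
  assumes "r \<le> M"
  shows "rational_dyck_paths r (M - r) =
    {p. length p = M \<and> count_list p East = r \<and>
        (\<forall>l \<le> M. l * r \<le> count_list (take l p) East * M)}"
proof -
  have "count_list p North = M - r \<longleftrightarrow> length p = M" if "count_list p East = r" for p
    using that count_East_North[of p] assms by auto
  moreover have "r * count_list (take l p) North \<le> (M - r) * count_list (take l p) East \<longleftrightarrow>
      l * r \<le> count_list (take l p) East * M" if "l \<le> length p" for l p
  proof -
    let ?i = "count_list (take l p) East" and ?j = "count_list (take l p) North"
    have "l = ?i + ?j"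
      using count_East_North[of "take l p"] that by simp
    then have "l * r = r * ?i + r * ?j"
      by (metis add_mult_distrib2 mult.commute)
    moreover have "?i * M = r * ?i + (M - r) * ?i"
      using assms by (simp add: mult.commute flip: add_mult_distrib)
    ultimately show ?thesis by simp
  qed
  ultimately show ?thesis
    by (auto simp: rational_dyck_paths_def)
qed

section \<open>Admissible words as step words\<close>

fun step_value :: "nat \<Rightarrow> step \<Rightarrow> real" where
  "step_value q East = real q / 2"
| "step_value q North = 1 / 2"

definition admissible_step_words :: "nat \<Rightarrow> nat \<Rightarrow> step list set" where
  "admissible_step_words q r =
     {p. count_list p East = r \<and> q ^ r < 2 ^ length p \<and>
         (\<forall>l. 1 \<le> l \<and> l < length p \<longrightarrow> 2 ^ l < q ^ count_list (take l p) East)}"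

lemma UNIV_step: "UNIV = {East, North}"
  using step.exhaust by auto

lemma inj_step_value:
  assumes "q \<noteq> 1"
  shows "inj (step_value q)"
proof (rule injI)
  fix s t
  assume "step_value q s = step_value q t"
  then show "s = t"
    using assms by (cases s; cases t) auto
qed

lemma prod_list_step_value:
  "prod_list (map (step_value q) p) = real q ^ count_list p East / 2 ^ length p"
proof (induction p)
  case (Cons s p)
  then show ?case by (cases s) auto
qed simp

lemma admissible_words_eq_image:
  assumes "q \<noteq> 1"
  shows "admissible_words q r = map (step_value q) ` admissible_step_words q r"
proof -
  have range: "range (step_value q) = {real q / 2, 1 / 2}"
    by (simp add: UNIV_step)
  have words: "set w \<subseteq> {real q / 2, 1 / 2} \<longleftrightarrow> w \<in> range (map (step_value q))" for w
    using range by (metis lists_UNIV lists_image in_lists_conv_set subset_code(1))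
  have count: "count_list (map (step_value q) p) (real q / 2) = count_list p East" for p
    using count_list_map_conv[OF inj_step_value[OF assms], of p East] by simp
  have less: "1 < real q ^ i / 2 ^ l \<longleftrightarrow> 2 ^ l < q ^ i" "real q ^ i / 2 ^ l < 1 \<longleftrightarrow> q ^ i < 2 ^ l" for i l
    by (simp_all flip: of_nat_less_iff[where 'a = real])
  have "map (step_value q) p \<in> admissible_words q r \<longleftrightarrow> p \<in> admissible_step_words q r" for p
    unfolding admissible_words_def admissible_step_words_def
    unfolding words by (auto simp: count take_map prod_list_step_value less)
  moreover have "admissible_words q r \<subseteq> range (map (step_value q))"
    unfolding admissible_words_def words by blast
  ultimately show ?thesis by blast
qed

lemma bij_betw_admissible_words:
  assumes "q \<noteq> 1"
  shows "bij_betw (map (step_value q)) (admissible_step_words q r) (admissible_words q r)"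
  unfolding admissible_words_eq_image[OF assms]
  using inj_mapI[OF inj_step_value[OF assms]]
  by (meson inj_on_imp_bij_betw inj_on_subset subset_UNIV)

section \<open>Powers of q and 2 compared through the logarithm\<close>

lemma odd_power_neq_power_2:
  fixes q :: nat
  assumes "odd q" and "1 \<le> l"
  shows "q ^ i \<noteq> 2 ^ l"
proof -
  have "odd (q ^ i)" and "even ((2::nat) ^ l)"
    using assms by auto
  then show ?thesis by metis
qed

lemma power_less_iff_log:
  fixes q :: nat
  assumes "2 \<le> q"
  shows "2 ^ l < q ^ i \<longleftrightarrow> real l < real i * log 2 (real q)"
    and "q ^ i < 2 ^ l \<longleftrightarrow> real i * log 2 (real q) < real l"
proof -
  have q: "real q ^ i = 2 powr (real i * log 2 (real q))"
  proof -
    have "2 powr (log 2 (real q) * real i) = (2 powr log 2 (real q)) powr real i"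
      by (simp only: powr_powr)
    also have "\<dots> = real q ^ i"
      using assms by (simp add: powr_realpow)
    finally show ?thesis by (simp only: mult.commute)
  qed
  have two: "(2::real) ^ l = 2 powr real l"
    by (simp add: powr_realpow)
  have "2 ^ l < q ^ i \<longleftrightarrow> (2::real) ^ l < real q ^ i"
    by (metis of_nat_less_iff of_nat_numeral of_nat_power)
  then show "2 ^ l < q ^ i \<longleftrightarrow> real l < real i * log 2 (real q)"
    unfolding q two by simp
  have "q ^ i < 2 ^ l \<longleftrightarrow> real q ^ i < (2::real) ^ l"
    by (metis of_nat_less_iff of_nat_numeral of_nat_power)
  then show "q ^ i < 2 ^ l \<longleftrightarrow> real i * log 2 (real q) < real l"
    unfolding q two by simp
qed

text \<open>Equality of the powers is excluded by parity for \<open>1 \<le> l\<close>, so the strict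
  comparison can be weakened to match the weak Dyck condition.\<close>

lemma power_less_iff_log_le:
  fixes q :: nat
  assumes "odd q" "2 \<le> q" "1 \<le> l"
  shows "2 ^ l < q ^ i \<longleftrightarrow> real l \<le> real i * log 2 (real q)"
  using odd_power_neq_power_2[OF assms(1,3), of i] power_less_iff_log(2)[OF assms(2), of i l]
  by (metis linorder_neqE_nat not_le order_less_asym)

text \<open>If n times the logarithm were equal to m, the weak comparison would hold and the strict
  one would fail, although both characterise 2^m < q^n for m >= 1.\<close>

lemma log_2_odd_irrational:
  fixes q :: nat
  assumes "odd q" "2 \<le> q"
  shows "log 2 (real q) \<notin> \<rat>"
proof
  assume "log 2 (real q) \<in> \<rat>"
  then obtain m n where n: "n \<noteq> 0" and mn: "\<bar>log 2 (real q)\<bar> = real m / real n"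
    by (rule Rats_abs_nat_div_natE)
  have pos: "0 < log 2 (real q)"
    using assms(2) by simp
  with mn n have eq: "real n * log 2 (real q) = real m"
    by (simp add: field_simps)
  with pos n have "1 \<le> m"
    by (metis less_one mult_eq_0_iff not_le of_nat_0 of_nat_eq_0_iff order_less_irrefl)
  then show False
    using power_less_iff_log_le[OF assms, of m n] power_less_iff_log(1)[OF assms(2), of m n] eq
    by simp
qed

lemma floor_log_bounds:
  fixes q :: nat
  assumes "1 \<le> q"
  shows "real (log2_floor q r) \<le> real r * log 2 (real q)"
    and "real r * log 2 (real q) < real (log2_floor q r) + 1"
proof -
  have "0 \<le> real r * log 2 (real q)"
    using assms by simp
  then show "real (log2_floor q r) \<le> real r * log 2 (real q)"
    and "real r * log 2 (real q) < real (log2_floor q r) + 1"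
    unfolding log2_floor_def by linarith+
qed

lemma int_log2_floor:
  assumes "1 \<le> q"
  shows "int (log2_floor q r) = \<lfloor>real r * log 2 (real q)\<rfloor>"
  using assms by (simp add: log2_floor_def)

lemma count_list_take_le: "count_list (take l p) x \<le> count_list p x"
proof -
  have "count_list (take l p) x + count_list (drop l p) x = count_list p x"
    by (simp flip: count_list_append)
  then show ?thesis by simp
qed

text \<open>The last inequality makes the length exceed m = \<open>log2_floor q r\<close>. In a word
  longer than m + 1, the prefix of length m + 1 would be proper, giving 2^(m+1) < q^i with i <= r,
  whereas q^r < 2^(m+1).\<close>

lemma length_admissible_step_words:
  assumes "odd q" "2 \<le> q" and p: "p \<in> admissible_step_words q r"
  shows "length p = log2_floor q r + 1"
proof (rule antisym)
  let ?m = "log2_floor q r" and ?x = "log 2 (real q)"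
  note bounds = floor_log_bounds[of q r]
  show "?m + 1 \<le> length p"
    using p bounds(1) assms(2) power_less_iff_log(2)[OF assms(2), of r "length p"]
    by (auto simp: admissible_step_words_def)
  show "length p \<le> ?m + 1"
  proof (rule ccontr)
    assume "\<not> length p \<le> ?m + 1"
    moreover have "\<forall>l. 1 \<le> l \<and> l < length p \<longrightarrow> 2 ^ l < q ^ count_list (take l p) East"
      using p by (simp add: admissible_step_words_def)
    ultimately have "2 ^ (?m + 1) < q ^ count_list (take (?m + 1) p) East"
      by (meson le_add2 not_le)
    also have "\<dots> \<le> q ^ r"
      using p assms(2) count_list_take_le[of "?m + 1" p East]
      by (intro power_increasing) (auto simp: admissible_step_words_def)
    finally show False
      using power_less_iff_log(1)[OF assms(2), of "?m + 1" r] bounds(2) assms(2) by simp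
  qed
qed

text \<open>Once the length is known, the condition on the whole product follows from the definition
  of the floor, and the proper prefixes carry all remaining information.\<close>

lemma admissible_step_words_alt:
  assumes "odd q" "2 \<le> q"
  shows "admissible_step_words q r =
    {p. length p = log2_floor q r + 1 \<and> count_list p East = r \<and>
        (\<forall>l. 1 \<le> l \<and> l \<le> log2_floor q r \<longrightarrow>
           real l \<le> real (count_list (take l p) East) * log 2 (real q))}"
proof -
  let ?m = "log2_floor q r"
  have less: "q ^ r < 2 ^ (?m + 1)"
    using power_less_iff_log(2)[OF assms(2), of r "log2_floor q r + 1"] floor_log_bounds(2)[of q r] assms
    by simp
  have "(\<forall>l. 1 \<le> l \<and> l < ?m + 1 \<longrightarrow> 2 ^ l < q ^ count_list (take l p) East) \<longleftrightarrow>
      (\<forall>l. 1 \<le> l \<and> l \<le> ?m \<longrightarrow> real l \<le> real (count_list (take l p) East) * log 2 (real q))" for p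
    using power_less_iff_log_le[OF assms] by (metis less_Suc_eq_le Suc_eq_plus1)
  then have "p \<in> admissible_step_words q r \<longleftrightarrow> count_list p East = r \<and>
      (\<forall>l. 1 \<le> l \<and> l \<le> ?m \<longrightarrow> real l \<le> real (count_list (take l p) East) * log 2 (real q))"
    if "length p = ?m + 1" for p
    using less unfolding admissible_step_words_def mem_Collect_eq that by blast
  then show ?thesis
    using length_admissible_step_words[OF assms] by blast
qed

section \<open>Admissible words and Dyck paths\<close>

lemma three_halves_le_log_2:
  assumes "3 \<le> q"
  shows "3 / 2 \<le> log 2 (real q)"
proof -
  have "(2::nat) ^ 3 < 3 ^ 2" by simp
  also have "\<dots> \<le> q ^ 2" using assms by (intro power_mono) auto
  finally show ?thesis
    using power_less_iff_log(1)[of q 3 2] assms by simp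
qed

lemma less_log2_floor:
  assumes "3 \<le> q" "2 \<le> r"
  shows "r < log2_floor q r"
proof -
  \<comment> \<open>The bound 3/2 is just large enough: r + 1 <= 3 r / 2 is equivalent to r >=
    2.\<close>
  have "real r + 1 \<le> real r * (3 / 2)"
    using assms(2) by simp
  also have "\<dots> \<le> real r * log 2 (real q)"
    using three_halves_le_log_2[OF assms(1)] by (intro mult_left_mono) auto
  finally show ?thesis
    using floor_log_bounds(2)[of q r] assms by linarith
qed

text \<open>Admissible words are one letter longer than the Dyck paths, and their last letter must
  be 1/2. On the first \<open>log2_floor q r\<close> letters the two prefix conditions agree by
  \<open>approx\<close>.\<close>

lemma admissible_step_words_lower:
  assumes q: "odd q" "3 \<le> q" and r: "2 \<le> r"
    and approx: "\<And>i l. i \<le> r \<Longrightarrow>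
      real l \<le> real i * log 2 (real q) \<longleftrightarrow> l * r \<le> i * log2_floor q r"
  shows "bij_betw (\<lambda>p. p @ [North]) (rational_dyck_paths r (log2_floor q r - r))
           (admissible_step_words q r)"
proof -
  let ?m = "log2_floor q r"
  have q2: "2 \<le> q" using q by simp
  have dyck: "rational_dyck_paths r (?m - r) = {p. length p = ?m \<and> count_list p East = r \<and>
      (\<forall>l. 1 \<le> l \<and> l \<le> ?m \<longrightarrow> real l \<le> real (count_list (take l p) East) * log 2 (real q))}"
  proof -
    have "(\<forall>l \<le> ?m. l * r \<le> count_list (take l p) East * ?m) \<longleftrightarrow>
        (\<forall>l. 1 \<le> l \<and> l \<le> ?m \<longrightarrow> real l \<le> real (count_list (take l p) East) * log 2 (real q))"
      (is "?L \<longleftrightarrow> ?R") if p: "count_list p East = r" for p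
    proof -
      have a: "real l \<le> real (count_list (take l p) East) * log 2 (real q) \<longleftrightarrow>
          l * r \<le> count_list (take l p) East * ?m" for l
        using approx[of "count_list (take l p) East" l] count_list_take_le[of l p East] p by simp
      show ?thesis
      proof
        assume R: ?R
        show ?L
        proof (intro allI impI)
          fix l assume "l \<le> ?m"
          with R a show "l * r \<le> count_list (take l p) East * ?m"
            by (cases "l = 0") auto
        qed
      qed (use a in blast)
    qed
    then show ?thesis
      unfolding rational_dyck_paths_slope[OF less_imp_le[OF less_log2_floor[OF q(2) r]]] by blast
  qed
  have "(\<lambda>p. p @ [North]) ` rational_dyck_paths r (?m - r) = admissible_step_words q r"
  proof (intro set_eqI iffI)
    fix p assume p: "p \<in> admissible_step_words q r"
    then have len: "length p = ?m + 1"
      using length_admissible_step_words[OF q(1) q2] by simp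
    then obtain p' s where ps: "p = p' @ [s]"
      by (metis add.commute length_Suc_conv_rev plus_1_eq_Suc)
    have "s = North"
    proof (rule ccontr)
      assume "s \<noteq> North"
      then have s: "s = East" by (cases s) auto
      have m: "1 \<le> ?m" using less_log2_floor[OF q(2) r] by simp
      have count: "count_list (take ?m p) East = r - 1"
        using p len by (auto simp: ps s admissible_step_words_def)
      \<comment> \<open>If the last letter were q/2, the prefix of length m would have only r - 1
        such letters, and (r - 1) log q < m + 1 - 3/2 < m, with logarithms to base 2.\<close>
      have "real ?m \<le> real (count_list (take ?m p) East) * log 2 (real q)"
        using p m unfolding admissible_step_words_alt[OF q(1) q2] by blast
      then have "real ?m \<le> real (r - 1) * log 2 (real q)"
        unfolding count .
      also have "\<dots> = real r * log 2 (real q) - log 2 (real q)"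
        using r by (simp add: of_nat_diff algebra_simps)
      finally show False
        using floor_log_bounds(2)[of q r] three_halves_le_log_2[OF q(2)] q2 by simp
    qed
    then show "p \<in> (\<lambda>p. p @ [North]) ` rational_dyck_paths r (?m - r)"
      using p len unfolding dyck admissible_step_words_alt[OF q(1) q2] ps by auto
  next
    fix p assume "p \<in> (\<lambda>p. p @ [North]) ` rational_dyck_paths r (?m - r)"
    then show "p \<in> admissible_step_words q r"
      unfolding dyck admissible_step_words_alt[OF q(1) q2] by auto
  qed
  then show ?thesis
    by (intro bij_betw_imageI inj_onI) auto
qed

text \<open>Words and paths now have equal length, so no letter is removed. At the endpoint, which
  \<open>approx\<close> leaves out, the Dyck inequality is an equality, while the admissibility
  condition in \<open>admissible_step_words_alt\<close> stops one letter earlier.\<close>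

lemma admissible_step_words_upper:
  assumes q: "odd q" "3 \<le> q" and r: "2 \<le> r"
    and approx: "\<And>i l. i \<le> r \<Longrightarrow> l \<noteq> log2_floor q r + 1 \<Longrightarrow>
      real l \<le> real i * log 2 (real q) \<longleftrightarrow> l * r \<le> i * (log2_floor q r + 1)"
  shows "rational_dyck_paths r (log2_floor q r + 1 - r) = admissible_step_words q r"
proof -
  let ?m = "log2_floor q r"
  have q2: "2 \<le> q" using q by simp
  have le: "r \<le> ?m + 1"
    using less_log2_floor[OF q(2) r] by simp
  have "(\<forall>l \<le> ?m + 1. l * r \<le> count_list (take l p) East * (?m + 1)) \<longleftrightarrow>
      (\<forall>l. 1 \<le> l \<and> l \<le> ?m \<longrightarrow> real l \<le> real (count_list (take l p) East) * log 2 (real q))"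
    (is "?L \<longleftrightarrow> ?R") if p: "count_list p East = r" "length p = ?m + 1" for p
  proof -
    have a: "real l \<le> real (count_list (take l p) East) * log 2 (real q) \<longleftrightarrow>
        l * r \<le> count_list (take l p) East * (?m + 1)" if "l \<le> ?m" for l
      using approx[of "count_list (take l p) East" l] count_list_take_le[of l p East] p that by simp
    show ?thesis
    proof
      assume ?L
      then show ?R using a by auto
    next
      assume R: ?R
      show ?L
      proof (intro allI impI)
        fix l assume "l \<le> ?m + 1"
        then consider "l = 0" | "1 \<le> l" "l \<le> ?m" | "l = ?m + 1" by linarith
        then show "l * r \<le> count_list (take l p) East * (?m + 1)"
          by cases (use R a p in auto)
      qed
    qed
  qed
  then show ?thesis
    unfolding rational_dyck_paths_slope[OF le] admissible_step_words_alt[OF q(1) q2] by blast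
qed

section \<open>The orders under consideration\<close>

text \<open>P/Q is the k-th convergent and p/r the intermediate fraction with parameter s. For odd k
  the former lies above the logarithm and the latter below; their determinant is that of two
  consecutive convergents, since the multiple s of (P, Q) cancels.\<close>

lemma lower_ordersE:
  assumes "odd q" "2 \<le> q" and "r \<in> lower_orders q"
  obtains p P Q :: int where "0 < Q" "P * int r - p * Q = 1"
    "of_int p < real r * log 2 (real q)" "of_int Q * log 2 (real q) < of_int P"
proof -
  let ?x = "log 2 (real q)"
  have irr: "?x \<notin> \<rat>"
    using assms(1,2) by (rule log_2_odd_irrational)
  obtain k s where k: "odd k" and s: "int s < cf_coeff ?x (Suc k)"
    and r: "r = s * cf_denom_shift ?x (Suc k) + cf_denom_shift ?x k"
    using assms(3) by (auto simp: lower_orders_def)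
  let ?P = "cf_num_shift ?x (Suc k)" and ?Q = "int (cf_denom_shift ?x (Suc k))"
  let ?p = "int s * ?P + cf_num_shift ?x k"
  show thesis
  proof (rule that[of ?Q ?P ?p])
    show "0 < ?Q"
      using cf_denom_shift_pos[OF irr, of k] by simp
    show "?P * int r - ?p * ?Q = 1"
      using cf_determinant[OF irr, of k] k by (simp add: r algebra_simps)
    show "of_int ?p < real r * ?x"
      using intermediate_error_sign[OF irr s] k by (simp add: r cf_error_def algebra_simps)
    show "of_int ?Q * ?x < of_int ?P"
      using cf_error_sign[OF irr, of "Suc k"] k by (simp add: cf_error_def)
  qed
qed

text \<open>The same fractions as in the lower case; for even k both sides and the sign of the
  determinant are reversed.\<close>

lemma upper_ordersE:
  assumes "odd q" "2 \<le> q" and "r \<in> upper_orders q"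
  obtains p P Q :: int where "0 < Q" "p * Q - P * int r = 1"
    "real r * log 2 (real q) < of_int p" "of_int P < of_int Q * log 2 (real q)"
proof -
  let ?x = "log 2 (real q)"
  have irr: "?x \<notin> \<rat>"
    using assms(1,2) by (rule log_2_odd_irrational)
  obtain k s where k: "even k" and s: "int s < cf_coeff ?x (Suc k)"
    and r: "r = s * cf_denom_shift ?x (Suc k) + cf_denom_shift ?x k"
    using assms(3) by (auto simp: upper_orders_def)
  let ?P = "cf_num_shift ?x (Suc k)" and ?Q = "int (cf_denom_shift ?x (Suc k))"
  let ?p = "int s * ?P + cf_num_shift ?x k"
  show thesis
  proof (rule that[of ?Q ?p ?P])
    show "0 < ?Q"
      using cf_denom_shift_pos[OF irr, of k] by simp
    show "?p * ?Q - ?P * int r = 1"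
      using cf_determinant[OF irr, of k] k by (simp add: r algebra_simps)
    show "real r * ?x < of_int ?p"
      using intermediate_error_sign[OF irr s] k by (simp add: r cf_error_def algebra_simps)
    show "of_int ?P < of_int ?Q * ?x"
      using cf_error_sign[OF irr, of "Suc k"] k by (simp add: cf_error_def)
  qed
qed

lemma lower_orders_approx:
  assumes "odd q" "2 \<le> q" "0 < r" and "r \<in> lower_orders q"
  shows "coprime r (log2_floor q r)"
    and "\<And>i l. i \<le> r \<Longrightarrow> real l \<le> real i * log 2 (real q) \<longleftrightarrow> l * r \<le> i * log2_floor q r"
proof -
  obtain p P Q :: int where pPQ: "0 < Q" "P * int r - p * Q = 1"
    "of_int p < real r * log 2 (real q)" "of_int Q * log 2 (real q) < of_int P"
    using lower_ordersE[OF assms(1,2,4)] .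
  have farey: "of_int n \<le> of_int i * log 2 (real q) \<longleftrightarrow> n * int r \<le> i * p"
    if "0 \<le> i" "i \<le> int r" for i n
    using that pPQ assms(3) by (intro farey_lower[of "int r" Q P p]) auto
  \<comment> \<open>The numerator p is identified as the floor: by the Farey criterion at i = r, the
    bound for p + 1 would require (p + 1) r <= r p.\<close>
  have "\<not> of_int (p + 1) \<le> real r * log 2 (real q)"
    using farey[of "int r" "p + 1"] assms(3) by (simp add: algebra_simps)
  with pPQ(3) have "\<lfloor>real r * log 2 (real q)\<rfloor> = p"
    by linarith
  then have m: "int (log2_floor q r) = p"
    using assms(2) by (simp add: int_log2_floor)
  have "coprime (int r) p"
    using pPQ(2) by (intro bezout_imp_coprime)
  then show "coprime r (log2_floor q r)"
    by (simp flip: m)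
  show "real l \<le> real i * log 2 (real q) \<longleftrightarrow> l * r \<le> i * log2_floor q r" if "i \<le> r" for i l
    using farey[of "int i" "int l"] assms(3) that
    by (simp flip: m of_nat_mult)
qed

lemma upper_orders_approx:
  assumes "odd q" "2 \<le> q" "0 < r" and "r \<in> upper_orders q"
  shows "coprime r (log2_floor q r + 1)"
    and "\<And>i l. i \<le> r \<Longrightarrow> l \<noteq> log2_floor q r + 1 \<Longrightarrow>
      real l \<le> real i * log 2 (real q) \<longleftrightarrow> l * r \<le> i * (log2_floor q r + 1)"
proof -
  obtain p P Q :: int where pPQ: "0 < Q" "p * Q - P * int r = 1"
    "real r * log 2 (real q) < of_int p" "of_int P < of_int Q * log 2 (real q)"
    using upper_ordersE[OF assms(1,2,4)] .
  have farey: "of_int n \<le> of_int i * log 2 (real q) \<longleftrightarrow> n * int r \<le> i * p"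
    if "0 \<le> i" "i \<le> int r" "(i, n) \<noteq> (int r, p)" for i n
    using that pPQ assms(3) by (intro farey_upper[of "int r" Q p P]) auto
  \<comment> \<open>The pair (r, p - 1) is not the excluded one, so the Farey criterion gives the
    lower bound p - 1; hence the floor is p - 1 and p is the floor plus 1.\<close>
  have "(p - 1) * int r \<le> int r * p"
    by (simp add: algebra_simps)
  then have "of_int (p - 1) \<le> real_of_int (int r) * log 2 (real q)"
    using assms(3) by (subst farey) auto
  then have "of_int (p - 1) \<le> real r * log 2 (real q)"
    by simp
  with pPQ(3) have "\<lfloor>real r * log 2 (real q)\<rfloor> = p - 1"
    by linarith
  then have m: "int (log2_floor q r + 1) = p"
    using assms(2) by (simp add: int_log2_floor)
  have "coprime (int r) p"
    using bezout_imp_coprime[of Q p "int r" P] pPQ(2) by (simp add: mult.commute coprime_commute)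
  then show "coprime r (log2_floor q r + 1)"
    by (metis m coprime_int_iff)
  show "real l \<le> real i * log 2 (real q) \<longleftrightarrow> l * r \<le> i * (log2_floor q r + 1)"
    if "i \<le> r" "l \<noteq> log2_floor q r + 1" for i l
  proof -
    \<comment> \<open>The condition \<open>l \<noteq> log2_floor q r + 1\<close> keeps the pair away
      from (r, p).\<close>
    have "real l \<le> real i * log 2 (real q) \<longleftrightarrow> int l * int r \<le> int i * p"
      using farey[of "int i" "int l"] assms(3) that m by auto
    then show ?thesis
      by (metis m of_nat_mult of_nat_le_iff)
  qed
qed

text \<open>Serves both cases, with \<open>M\<close> the floor or the floor plus 1. Coprimality
  passes from \<open>M\<close> to \<open>M - r\<close>, as the cycle lemma requires, and r + (M - r)
  = M rewrites the Catalan number.\<close>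

lemma dyck_bijection_consequences:
  assumes "q \<noteq> 1" "0 < r" "r \<le> M" "coprime r M"
    and "bij_betw g (rational_dyck_paths r (M - r)) (admissible_step_words q r)"
  shows "coprime r (M - r) \<and>
    real (num_admissible q r) = rational_catalan r (M - r) \<and>
    rational_catalan r (M - r) = 1 / real M * real (M choose r) \<and>
    (\<exists>f. bij_betw f (admissible_words q r) (rational_dyck_paths r (M - r)))"
proof -
  have cop: "coprime r (M - r)"
    using assms(3,4) by (metis coprime_iff_gcd_eq_1 gcd.commute gcd_diff1_nat)
  have "bij_betw (map (step_value q) \<circ> g) (rational_dyck_paths r (M - r)) (admissible_words q r)"
    using assms(5) bij_betw_admissible_words[OF assms(1)] by (rule bij_betw_trans)
  then obtain f where f: "bij_betw f (admissible_words q r) (rational_dyck_paths r (M - r))"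
    by (meson bij_betw_inv)
  then have "real (num_admissible q r) = rational_catalan r (M - r)"
    using card_rational_dyck_paths_catalan[OF cop assms(2)]
    by (simp add: num_admissible_def bij_betw_same_card[OF f])
  moreover have "rational_catalan r (M - r) = 1 / real M * real (M choose r)"
    using assms(3) by (simp add: rational_catalan_def)
  ultimately show ?thesis
    using cop f by blast
qed

theorem theorem8:
  fixes q r :: nat
  assumes "odd q" and "q \<ge> 3" and "r \<ge> 2"
  shows "int (log2_floor q r) - int r > 0 \<and>
    (r \<in> lower_orders q \<longrightarrow>
       coprime r (log2_floor q r - r) \<and>
       real (num_admissible q r) = rational_catalan r (log2_floor q r - r) \<and>
       rational_catalan r (log2_floor q r - r) =
         1 / real (log2_floor q r) * real (log2_floor q r choose r) \<and>
       (\<exists>f. bij_betw f (admissible_words q r) (rational_dyck_paths r (log2_floor q r - r)))) \<and>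
    (r \<in> upper_orders q \<longrightarrow>
       coprime r (log2_floor q r + 1 - r) \<and>
       real (num_admissible q r) = rational_catalan r (log2_floor q r + 1 - r) \<and>
       rational_catalan r (log2_floor q r + 1 - r) =
         1 / real (log2_floor q r + 1) * real ((log2_floor q r + 1) choose r) \<and>
       (\<exists>f. bij_betw f (admissible_words q r) (rational_dyck_paths r (log2_floor q r + 1 - r))))"
proof (intro conjI[of "_ > _"] conjI[of "_ \<longrightarrow> _"] impI)
  have q: "2 \<le> q" "q \<noteq> 1" and r: "0 < r"
    using assms by auto
  have less: "r < log2_floor q r"
    using assms(2,3) by (rule less_log2_floor)
  then show "int (log2_floor q r) - int r > 0" by simp
  {
    assume lower: "r \<in> lower_orders q"
    note approx = lower_orders_approx[OF assms(1) q(1) r lower]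
    show "coprime r (log2_floor q r - r) \<and>
       real (num_admissible q r) = rational_catalan r (log2_floor q r - r) \<and>
       rational_catalan r (log2_floor q r - r) =
         1 / real (log2_floor q r) * real (log2_floor q r choose r) \<and>
       (\<exists>f. bij_betw f (admissible_words q r) (rational_dyck_paths r (log2_floor q r - r)))"
      using dyck_bijection_consequences[OF q(2) r less_imp_le[OF less] approx(1)
          admissible_step_words_lower[OF assms approx(2)]] .
  }
  {
    assume upper: "r \<in> upper_orders q"
    note approx = upper_orders_approx[OF assms(1) q(1) r upper]
    have "bij_betw id (rational_dyck_paths r (log2_floor q r + 1 - r)) (admissible_step_words q r)"
      using admissible_step_words_upper[OF assms approx(2)] by simp
    then show "coprime r (log2_floor q r + 1 - r) \<and>
       real (num_admissible q r) = rational_catalan r (log2_floor q r + 1 - r) \<and>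
       rational_catalan r (log2_floor q r + 1 - r) =
         1 / real (log2_floor q r + 1) * real ((log2_floor q r + 1) choose r) \<and>
       (\<exists>f. bij_betw f (admissible_words q r) (rational_dyck_paths r (log2_floor q r + 1 - r)))"
      using less by (intro dyck_bijection_consequences[OF q(2) r _ approx(1)]) auto
  }
qed

end
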